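(* Let $k$ be a field of characteristic $p>0$ and let $(\mathfrak g,[-,-],(-)^{[p]},\blacktriangleright)$ be a trivially restricted post-Lie algebra over $k$. Then $(\mathfrak g,\llbracket-,-\rrbracket,(-)^{[p]_\blacktriangleright})$ is a restricted Lie algebra, where $\llbracket x,y\rrbracket=[x,y]+x\blacktriangleright y-y\blacktriangleright x$ is the sub-adjacent Lie bracket. In addition, $x\mapsto x\blacktriangleright(-)$ is a restricted representation of the restricted Lie algebra $(\mathfrak g,\llbracket-,-\rrbracket,(-)^{[p]_\blacktriangleright})$ on $\mathfrak g$.
   Context: A post-Lie algebra is a Lie algebra $(\mathfrak g,[-,-])$ over $k$ with a bilinear operation $\blacktriangleright$ such that for all $x,y,z$: $x\blacktriangleright[y,z]=[x\blacktriangleright y,z]+[y,x\blacktriangleright z]$ and $[x,y]\blacktriangleright z=a_\blacktriangleright(x,y,z)-a_\blacktriangleright(y,x,z)$, with $a_\blacktriangleright(x,y,z)=x\blacktriangleright(y\blacktriangleright z)-(x\blacktriangleright y)\blacktriangleright z$. Restricted Lie algebra is in the sense of Jacobson. For a post-Lie product on a restricted Lie algebra $(\mathfrak g,[-,-],(-)^{[p]})$, define $$x^{[p]_\blacktriangleright}:=x^{[p]}+\sum_{n=1}^{p-1}\frac1n\sum_{\substack{\ell_1+\cdots+\ell_n=p\\ \ell_i\ge1}}\frac{(p-1)!}{(\ell_1-1)!\cdots(\ell_n-1)!}\prod_{1\le v\le n-1}(\ell_1+\cdots+\ell_v)^{-1}\,[x^{\bullet\ell_1}\cdots x^{\bullet\ell_n}],$$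 where $x^{\bullet1}=x$, $x^{\bullet n}=x\blacktriangleright x^{\bullet(n-1)}$ and $[x_1\cdots x_n]=[x_1,[x_2,\cdots[x_{n-1},x_n]\cdots]]$ (equal to $x_1$ if $n=1$). Such a structure $(\mathfrak g,[-,-],(-)^{[p]},\blacktriangleright)$ is a trivially restricted post-Lie algebra if for all $x,y\in\mathfrak g$: (i) $x^{[p]_\blacktriangleright}\blacktriangleright y=x\blacktriangleright(\cdots(x\blacktriangleright(x\blacktriangleright y))\cdots)$ ($p$ occurrences of $x$), and (ii) $y\blacktriangleright x^{[p]}=\mathrm{ad}_x^{p-1}(y\blacktriangleright x)$, where $\mathrm{ad}_x=[x,-]$. A restricted representation of a restricted Lie algebra $\mathfrak h$ with $p$-map $(-)^{[p]_{\mathfrak h}}$ on a vector space $V$ is a Lie algebra morphism $\varphi:\mathfrak h\to\mathrm{End}(V)$ with $\varphi(h^{[p]_{\mathfrak h}})=\varphi(h)^p$. *)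

theory Defs
  imports Main "HOL-Computational_Algebra.Polynomial"
begin

definition bilinear_op ::
    "('k::field \<Rightarrow> 'g::ab_group_add \<Rightarrow> 'g) \<Rightarrow> ('g \<Rightarrow> 'g \<Rightarrow> 'g) \<Rightarrow> bool" where
  "bilinear_op scale f \<longleftrightarrow>
     (\<forall>x. Vector_Spaces.linear scale scale (f x)) \<and>
     (\<forall>y. Vector_Spaces.linear scale scale (\<lambda>x. f x y))"

locale lie_algebra = vector_space scale
  for scale :: "'k::field \<Rightarrow> 'g::ab_group_add \<Rightarrow> 'g" +
  fixes br :: "'g \<Rightarrow> 'g \<Rightarrow> 'g"
  assumes bilinear_br: "bilinear_op scale br"
    and br_self: "br x x = 0"
    and jacobi: "br x (br y z) + br y (br z x) + br z (br x y) = 0"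

(* The type 'g poly (with its additive structure only) plays the role of g \<otimes> k[t];
   poly_br is the bracket of g extended k[t]-bilinearly. *)
definition poly_br ::
    "('g::ab_group_add \<Rightarrow> 'g \<Rightarrow> 'g) \<Rightarrow> 'g poly \<Rightarrow> 'g poly \<Rightarrow> 'g poly" where
  "poly_br br f g =
     (\<Sum>i\<le>degree f. \<Sum>j\<le>degree g. monom (br (coeff f i) (coeff g j)) (i + j))"

(* Jacobson's s_i(x,y): i * s_i(x,y) is the coefficient of t^(i-1) in ad(t x + y)^(p-1) (x).
   Note that [:y, x:] is t x + y. *)
definition jacobson_s ::
    "('k::field \<Rightarrow> 'g::ab_group_add \<Rightarrow> 'g) \<Rightarrow> ('g \<Rightarrow> 'g \<Rightarrow> 'g) \<Rightarrow> nat \<Rightarrow> nat \<Rightarrow> 'g \<Rightarrow> 'g \<Rightarrow> 'g" where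
  "jacobson_s scale br p i x y =
     scale (inverse (of_nat i)) (coeff ((poly_br br [:y, x:] ^^ (p - 1)) [:x:]) (i - 1))"

locale restricted_lie_algebra = lie_algebra scale br
  for scale :: "'k::field \<Rightarrow> 'g::ab_group_add \<Rightarrow> 'g" and br :: "'g \<Rightarrow> 'g \<Rightarrow> 'g" +
  fixes p :: nat and pmap :: "'g \<Rightarrow> 'g"
  assumes char_p: "CHAR('k) = p" and p_pos: "p > 0"
    and pmap_scale: "pmap (scale a x) = scale (a ^ p) (pmap x)"
    and pmap_add: "pmap (x + y) = pmap x + pmap y + (\<Sum>i=1..p-1. jacobson_s scale br p i x y)"
    and ad_pmap: "br (pmap x) y = (br x ^^ p) y"

locale post_lie_algebra = lie_algebra scale br
  for scale :: "'k::field \<Rightarrow> 'g::ab_group_add \<Rightarrow> 'g" and br :: "'g \<Rightarrow> 'g \<Rightarrow> 'g" +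
  fixes tr :: "'g \<Rightarrow> 'g \<Rightarrow> 'g"  (infixr \<open>\<triangleright>\<close> 70)
  assumes bilinear_tr: "bilinear_op scale (\<triangleright>)"
    and tr_br: "x \<triangleright> br y z = br (x \<triangleright> y) z + br y (x \<triangleright> z)"
    and br_tr: "br x y \<triangleright> z =
      (x \<triangleright> (y \<triangleright> z) - (x \<triangleright> y) \<triangleright> z) - (y \<triangleright> (x \<triangleright> z) - (y \<triangleright> x) \<triangleright> z)"

definition sub_adjacent :: "('g::ab_group_add \<Rightarrow> 'g \<Rightarrow> 'g) \<Rightarrow> ('g \<Rightarrow> 'g \<Rightarrow> 'g) \<Rightarrow> 'g \<Rightarrow> 'g \<Rightarrow> 'g" where
  "sub_adjacent br tr x y = br x y + tr x y - tr y x"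

(* x, tr x x, tr x (tr x x), ... for n = 1, 2, 3, ...; only used for n \<ge> 1 *)
definition tr_power :: "('g \<Rightarrow> 'g \<Rightarrow> 'g) \<Rightarrow> 'g \<Rightarrow> nat \<Rightarrow> 'g" where
  "tr_power tr x n = (tr x ^^ (n - 1)) x"

(* The value on the empty list is never used. *)
fun nested_br :: "('g::zero \<Rightarrow> 'g \<Rightarrow> 'g) \<Rightarrow> 'g list \<Rightarrow> 'g" where
  "nested_br br [] = 0"
| "nested_br br [x] = x"
| "nested_br br (x # y # zs) = br x (nested_br br (y # zs))"

definition compositions :: "nat \<Rightarrow> nat \<Rightarrow> nat list set" where
  "compositions m n = {ls. length ls = n \<and> sum_list ls = m \<and> (\<forall>l\<in>set ls. l \<ge> 1)}"

(* The scalars live in a field of characteristic p; all denominators below are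
   nonzero there, since each l is at most p and each proper partial sum is less than p. *)
definition composition_coeff :: "nat \<Rightarrow> nat list \<Rightarrow> 'k::field" where
  "composition_coeff p ls =
     of_nat (fact (p - 1)) / (\<Prod>l\<leftarrow>ls. of_nat (fact (l - 1)))
     * (\<Prod>v=1..length ls - 1. inverse (of_nat (sum_list (take v ls))))"

definition post_lie_pmap ::
    "('k::field \<Rightarrow> 'g::ab_group_add \<Rightarrow> 'g) \<Rightarrow> ('g \<Rightarrow> 'g \<Rightarrow> 'g) \<Rightarrow> nat \<Rightarrow> ('g \<Rightarrow> 'g) \<Rightarrow>
     ('g \<Rightarrow> 'g \<Rightarrow> 'g) \<Rightarrow> 'g \<Rightarrow> 'g" where
  "post_lie_pmap scale br p pmap tr x =
     pmap x + (\<Sum>n=1..p-1. scale (1 / of_nat n)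
       (\<Sum>ls\<in>compositions p n.
          scale (composition_coeff p ls) (nested_br br (map (tr_power tr x) ls))))"

locale trivially_restricted_post_lie_algebra =
  restricted_lie_algebra scale br p pmap + post_lie_algebra scale br tr
  for scale :: "'k::field \<Rightarrow> 'g::ab_group_add \<Rightarrow> 'g" and br :: "'g \<Rightarrow> 'g \<Rightarrow> 'g"
    and p :: nat and pmap :: "'g \<Rightarrow> 'g" and tr :: "'g \<Rightarrow> 'g \<Rightarrow> 'g"  (infixr \<open>\<triangleright>\<close> 70) +
  assumes post_lie_pmap_tr: "post_lie_pmap scale br p pmap (\<triangleright>) x \<triangleright> y = ((\<triangleright>) x ^^ p) y"
    and tr_pmap: "y \<triangleright> pmap x = (br x ^^ (p - 1)) (y \<triangleright> x)"

locale restricted_representation =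
  restricted_lie_algebra scale br p pmap + V: vector_space scaleV
  for scale :: "'k::field \<Rightarrow> 'h::ab_group_add \<Rightarrow> 'h" and br :: "'h \<Rightarrow> 'h \<Rightarrow> 'h"
    and p :: nat and pmap :: "'h \<Rightarrow> 'h"
    and scaleV :: "'k \<Rightarrow> 'v::ab_group_add \<Rightarrow> 'v" +
  fixes rep :: "'h \<Rightarrow> 'v \<Rightarrow> 'v"
  assumes rep_endo: "Vector_Spaces.linear scaleV scaleV (rep x)"
    and rep_add: "rep (x + y) v = rep x v + rep y v"
    and rep_scale: "rep (scale a x) v = scaleV a (rep x v)"
    and rep_br: "rep (br x y) v = rep x (rep y v) - rep y (rep x v)"
    and rep_pmap: "rep (pmap x) = rep x ^^ p"

end

(* On vectors v, let omega z v = (ad z)^(p-1) v.  In characteristic p this is a closed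
   one-form on any Lie algebra: for commuting derivations d, e one has
   d (omega z (e z)) = e (omega z (d z)), by the Leibniz rule and p | (p choose k).  Taking for e the
   derivative d/dt on L[t] and z = t x + y, it follows that the sum S x y of Jacobson's s_i x y
   satisfies d (S x y) = omega (x + y) (d x + d y) - omega x (d x) - omega y (d y)
   for every derivation d.  With d inner this is Jacobson's formula for (ad (x + y))^p; with
   d = d/dt on L[t] it shows that S is a symmetric 2-cocycle, since a polynomial of degree < p
   with derivative 0 is constant.

   For a post-Lie algebra g let h be the semidirect product of (g, sub_adjacent) acting on (g, br)
   by the post-Lie product; x |-> (x, x) embeds the sub-adjacent Lie algebra into h.  Expanding
   (t ad_x + D)^(p-1) x for the derivation D = (tr x) identifies the sum over compositions
   with S (0, x) (x, 0) in h, and the Jacobson identities for the new p-map follow from the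
   cocycle property and from Jacobson's formula in h. *)
theory Submission
  imports Defs "HOL-Library.Product_Plus"
begin

section \<open>Bilinear operations, derivations and homomorphisms in elementary form\<close>

lemma bilinear_op_iff:
  "bilinear_op s f \<longleftrightarrow> vector_space s \<and>
     (\<forall>x y z. f x (y + z) = f x y + f x z) \<and> (\<forall>x y z. f (x + y) z = f x z + f y z) \<and>
     (\<forall>c x y. f x (s c y) = s c (f x y)) \<and> (\<forall>c x y. f (s c x) y = s c (f x y))"
  unfolding bilinear_op_def Vector_Spaces.linear_iff by blast

definition lie_derivation ::
    "('k::field \<Rightarrow> 'g::ab_group_add \<Rightarrow> 'g) \<Rightarrow> ('g \<Rightarrow> 'g \<Rightarrow> 'g) \<Rightarrow> ('g \<Rightarrow> 'g) \<Rightarrow> bool" where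
  "lie_derivation s b d \<longleftrightarrow> (\<forall>x y. d (x + y) = d x + d y) \<and> (\<forall>c x. d (s c x) = s c (d x)) \<and>
     (\<forall>x y. d (b x y) = b (d x) y + b x (d y))"

definition lie_hom ::
    "('k::field \<Rightarrow> 'g::ab_group_add \<Rightarrow> 'g) \<Rightarrow> ('g \<Rightarrow> 'g \<Rightarrow> 'g) \<Rightarrow>
     ('k \<Rightarrow> 'h::ab_group_add \<Rightarrow> 'h) \<Rightarrow> ('h \<Rightarrow> 'h \<Rightarrow> 'h) \<Rightarrow> ('g \<Rightarrow> 'h) \<Rightarrow> bool" where
  "lie_hom s b s' b' h \<longleftrightarrow> (\<forall>x y. h (x + y) = h x + h y) \<and> (\<forall>c x. h (s c x) = s' c (h x)) \<and>
     (\<forall>x y. h (b x y) = b' (h x) (h y))"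

lemma additive_zero:
  fixes h :: "'a::ab_group_add \<Rightarrow> 'b::ab_group_add"
  assumes "\<And>x y. h (x + y) = h x + h y"
  shows "h 0 = 0"
  using assms[of 0 0] by simp

lemma additive_sum:
  fixes h :: "'a::ab_group_add \<Rightarrow> 'b::ab_group_add"
  assumes "\<And>x y. h (x + y) = h x + h y"
  shows "h (sum f A) = (\<Sum>a\<in>A. h (f a))"
  using sum_comp_morphism[of h f A, OF additive_zero[of h] assms] assms by (simp add: o_def)

lemma additive_diff:
  fixes h :: "'a::ab_group_add \<Rightarrow> 'b::ab_group_add"
  assumes "\<And>x y. h (x + y) = h x + h y"
  shows "h (x - y) = h x - h y"
  using assms[of "x - y" y] by (simp add: algebra_simps)

lemma additive_minus:
  fixes h :: "'a::ab_group_add \<Rightarrow> 'b::ab_group_add"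
  assumes "\<And>x y. h (x + y) = h x + h y"
  shows "h (- y) = - h y"
  using additive_diff[of h 0 y, OF assms] additive_zero[of h, OF assms] by simp

section \<open>Polynomials with vector coefficients\<close>

definition poly_scale :: "('k \<Rightarrow> 'g::ab_group_add \<Rightarrow> 'g) \<Rightarrow> 'k \<Rightarrow> 'g poly \<Rightarrow> 'g poly" where
  "poly_scale s c = map_poly (s c)"

text \<open>The formal derivative d/dt; the factor i + 1 acts through the field, so it vanishes when
  the characteristic divides it.\<close>

definition poly_diff :: "('k::field \<Rightarrow> 'g::ab_group_add \<Rightarrow> 'g) \<Rightarrow> 'g poly \<Rightarrow> 'g poly" where
  "poly_diff s f = (\<Sum>i<degree f. monom (s (of_nat (Suc i)) (coeff f (Suc i))) i)"

text \<open>Evaluation at t = 1, needed because \<^const>\<open>poly\<close> requires a ring of coefficients.\<close>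
definition poly_eval1 :: "'g::ab_group_add poly \<Rightarrow> 'g" where
  "poly_eval1 f = (\<Sum>i\<le>degree f. coeff f i)"

lemma poly_eval1_altdef:
  assumes "degree f \<le> n"
  shows "poly_eval1 f = (\<Sum>i\<le>n. coeff f i)"
  unfolding poly_eval1_def using assms
  by (intro sum.mono_neutral_left) (auto simp: coeff_eq_0)

lemma poly_eval1_0 [simp]: "poly_eval1 0 = 0"
  by (simp add: poly_eval1_def)

lemma poly_eval1_pCons [simp]: "poly_eval1 (pCons a f) = a + poly_eval1 f"
proof -
  have "poly_eval1 (pCons a f) = (\<Sum>i\<le>Suc (degree f). coeff (pCons a f) i)"
    by (rule poly_eval1_altdef) (rule degree_pCons_le)
  then show ?thesis
    by (simp add: sum.atMost_Suc_shift poly_eval1_def del: sum.atMost_Suc)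
qed

lemma poly_eval1_add: "poly_eval1 (f + g) = poly_eval1 f + poly_eval1 g"
proof -
  let ?n = "max (degree f) (degree g)"
  have "poly_eval1 (f + g) = (\<Sum>i\<le>?n. coeff (f + g) i)"
    by (rule poly_eval1_altdef) (rule degree_add_le_max)
  then show ?thesis
    using poly_eval1_altdef[of f ?n] poly_eval1_altdef[of g ?n] by (simp add: sum.distrib)
qed

section \<open>Bracket identities and the Lie algebra L[t]\<close>

context lie_algebra
begin

lemma br_add_right: "br x (y + z) = br x y + br x z"
  and br_add_left: "br (x + y) z = br x z + br y z"
  and br_scale_right: "br x (scale c y) = scale c (br x y)"
  and br_scale_left: "br (scale c x) y = scale c (br x y)"
  using bilinear_br by (simp_all add: bilinear_op_iff)

lemma br_zero_right [simp]: "br x 0 = 0"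
  using br_add_right[of x 0 0] by simp

lemma br_zero_left [simp]: "br 0 x = 0"
  using br_add_left[of 0 0 x] by simp

lemma br_anticomm: "br x y = - br y x"
proof -
  have "br x y + br y x = 0"
    using br_self[of "x + y"] br_self[of x] br_self[of y]
    by (simp add: br_add_left br_add_right add.commute)
  then show ?thesis
    by (simp add: eq_neg_iff_add_eq_0)
qed

lemma br_minus_left: "br (- x) y = - br x y"
  using br_add_left[of x "- x" y] by (simp add: eq_neg_iff_add_eq_0 add.commute)

lemma br_minus_right: "br x (- y) = - br x y"
  using br_add_right[of x y "- y"] by (simp add: eq_neg_iff_add_eq_0 add.commute)

lemma br_diff_right: "br x (y - z) = br x y - br x z"
  using br_add_right[of x y "- z"] by (simp add: br_minus_right)

lemma br_diff_left: "br (x - y) z = br x z - br y z"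
  using br_add_left[of x "- y" z] by (simp add: br_minus_left)

lemma br_sum_right: "br x (\<Sum>i\<in>A. f i) = (\<Sum>i\<in>A. br x (f i))"
  by (rule additive_sum) (rule br_add_right)

lemma br_jacobi_derivation: "br x (br y z) = br (br x y) z + br y (br x z)"
proof -
  have "br y (br z x) = - br y (br x z)"
    by (subst br_anticomm[of z x]) (rule br_minus_right)
  moreover have "br z (br x y) = - br (br x y) z"
    by (rule br_anticomm)
  ultimately show ?thesis
    using jacobi[of x y z] by (simp add: algebra_simps)
qed

lemma lie_derivation_br: "lie_derivation scale br (br w)"
  unfolding lie_derivation_def using br_add_right br_scale_right br_jacobi_derivation by blast

text \<open>Coefficients beyond the degrees are zero, so the double sum can be regrouped by total
  degree. The convolution form allows identities to be checked coefficientwise.\<close>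

lemma coeff_poly_br: "coeff (poly_br br f g) n = (\<Sum>i\<le>n. br (coeff f i) (coeff g (n - i)))"
proof -
  have inner: "(\<Sum>j\<le>degree g. if i + j = n then br (coeff f i) (coeff g j) else 0) =
      (if i \<le> n then br (coeff f i) (coeff g (n - i)) else 0)" for i
  proof (cases "i \<le> n")
    case True
    have "(\<Sum>j\<le>degree g. if i + j = n then br (coeff f i) (coeff g j) else 0) =
        (\<Sum>j\<le>degree g. if n - i = j then br (coeff f i) (coeff g j) else 0)"
      by (intro sum.cong) (use True in auto)
    then show ?thesis
      using True by (simp add: sum.delta' coeff_eq_0)
  next
    case False
    then show ?thesis
      by (auto intro!: sum.neutral)
  qed
  have "coeff (poly_br br f g) n =
      (\<Sum>i\<le>degree f. \<Sum>j\<le>degree g. if i + j = n then br (coeff f i) (coeff g j) else 0)"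
    by (simp add: poly_br_def coeff_sum)
  also have "\<dots> = (\<Sum>i\<le>degree f. if i \<le> n then br (coeff f i) (coeff g (n - i)) else 0)"
    by (simp only: inner)
  also have "\<dots> = (\<Sum>i\<le>n. br (coeff f i) (coeff g (n - i)))"
    by (rule sum.mono_neutral_cong) (auto simp: coeff_eq_0)
  finally show ?thesis .
qed

lemma poly_br_add_left: "poly_br br (f + g) h = poly_br br f h + poly_br br g h"
  by (rule poly_eqI) (simp add: coeff_poly_br br_add_left sum.distrib)

lemma poly_br_add_right: "poly_br br f (g + h) = poly_br br f g + poly_br br f h"
  by (rule poly_eqI) (simp add: coeff_poly_br br_add_right sum.distrib)

lemma poly_br_zero [simp]: "poly_br br 0 f = 0" "poly_br br f 0 = 0"
  by (rule poly_eqI, simp add: coeff_poly_br)+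

lemma coeff_poly_br_const: "coeff (poly_br br [:a:] g) n = br a (coeff g n)"
  by (cases n) (simp_all add: coeff_poly_br sum.atMost_Suc_shift del: sum.atMost_Suc)

lemma poly_br_const_pCons [simp]:
  "poly_br br [:a:] (pCons b g) = pCons (br a b) (poly_br br [:a:] g)"
  by (rule poly_eqI) (auto simp: coeff_poly_br_const coeff_pCons split: nat.splits)

text \<open>The decomposition a + t f of the left factor drives the inductions on polynomials
  below.\<close>

lemma poly_br_pCons_left:
  "poly_br br (pCons a f) g = poly_br br [:a:] g + pCons 0 (poly_br br f g)"
proof (rule poly_eqI)
  fix n
  show "coeff (poly_br br (pCons a f) g) n = coeff (poly_br br [:a:] g + pCons 0 (poly_br br f g)) n"
    by (cases n)
      (simp_all add: coeff_poly_br_const coeff_poly_br[of "pCons a f"] coeff_poly_br[of f]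
        sum.atMost_Suc_shift del: sum.atMost_Suc)
qed

lemma poly_br_anticomm: "poly_br br f g = - poly_br br g f"
proof (rule poly_eqI)
  fix n
  have "(\<Sum>i\<le>n. br (coeff f i) (coeff g (n - i))) = (\<Sum>i\<le>n. br (coeff f (n - i)) (coeff g (n - (n - i))))"
    by (rule sum.reindex_bij_witness[of _ "\<lambda>i. n - i" "\<lambda>i. n - i"]) auto
  also have "\<dots> = (\<Sum>i\<le>n. - br (coeff g i) (coeff f (n - i)))"
    by (intro sum.cong refl, subst br_anticomm) simp
  finally show "coeff (poly_br br f g) n = coeff (- poly_br br g f) n"
    by (simp add: coeff_poly_br sum_negf)
qed

lemma poly_br_shift_left [simp]: "poly_br br (pCons 0 f) g = pCons 0 (poly_br br f g)"
  using poly_br_pCons_left[of 0 f g] by simp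

lemma poly_br_shift_right [simp]: "poly_br br f (pCons 0 g) = pCons 0 (poly_br br f g)"
  by (subst (1 2) poly_br_anticomm) simp

lemma pCons_split: "pCons a f = [:a:] + pCons 0 f" for a :: 'g
  by simp

lemma pCons_0_add: "pCons 0 (f + g) = pCons 0 f + pCons 0 g" for f g :: "'g poly"
  by simp

text \<open>For a + t f the cross terms cancel by anticommutativity. In characteristic 2,
  anticommutativity alone would not give the claim.\<close>

lemma poly_br_self: "poly_br br f f = 0"
proof (induction f)
  case (pCons a f)
  have "poly_br br (pCons a f) (pCons a f) = poly_br br [:a:] [:a:] + pCons 0 (pCons 0 (poly_br br f f))
      + (pCons 0 (poly_br br [:a:] f) + pCons 0 (poly_br br f [:a:]))"
    by (simp only: pCons_split[of a f] poly_br_add_left poly_br_add_right poly_br_shift_left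
        poly_br_shift_right pCons_0_add ac_simps)
  then show ?case
    using pCons poly_br_anticomm[of f "[:a:]"] by (simp add: br_self)
qed simp

text \<open>The Jacobi expression is additive in each argument and commutes with multiplication by
  t, so induction on one argument after another reduces it to constants.\<close>

lemma poly_br_jacobi:
  "poly_br br f (poly_br br g h) + poly_br br g (poly_br br h f) + poly_br br h (poly_br br f g) = 0"
    (is "?J f g h = 0")
proof -
  have const: "?J [:a:] [:b:] [:c:] = 0" for a b c
    by (simp add: jacobi)
  have const2: "?J [:a:] [:b:] h = 0" for a b h
  proof (induction h)
    case (pCons c h)
    have "?J [:a:] [:b:] (pCons c h) = ?J [:a:] [:b:] [:c:] + pCons 0 (?J [:a:] [:b:] h)"
      by (simp only: pCons_split[of c h] poly_br_add_left poly_br_add_right poly_br_shift_left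
          poly_br_shift_right pCons_0_add ac_simps)
    then show ?case
      using const pCons by simp
  qed simp
  have const1: "?J [:a:] g h = 0" for a g h
  proof (induction g)
    case (pCons c g)
    have "?J [:a:] (pCons c g) h = ?J [:a:] [:c:] h + pCons 0 (?J [:a:] g h)"
      by (simp only: pCons_split[of c g] poly_br_add_left poly_br_add_right poly_br_shift_left
          poly_br_shift_right pCons_0_add ac_simps)
    then show ?case
      using const2 pCons by simp
  qed simp
  show ?thesis
  proof (induction f)
    case (pCons c f)
    have "?J (pCons c f) g h = ?J [:c:] g h + pCons 0 (?J f g h)"
      by (simp only: pCons_split[of c f] poly_br_add_left poly_br_add_right poly_br_shift_left
          poly_br_shift_right pCons_0_add ac_simps)
    then show ?case
      using const1 pCons by simp
  qed simp
qed

lemma coeff_poly_scale [simp]: "coeff (poly_scale scale c f) n = scale c (coeff f n)"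
  by (simp add: poly_scale_def coeff_map_poly)

lemma degree_poly_scale_le: "degree (poly_scale scale c f) \<le> degree f"
  by (intro degree_le) (simp add: coeff_eq_0)

lemma coeff_poly_diff [simp]:
  "coeff (poly_diff scale f) n = scale (of_nat (Suc n)) (coeff f (Suc n))"
  by (auto simp: poly_diff_def coeff_sum sum.delta' coeff_eq_0)

text \<open>L[t] is taken over the field k, because d/dt is linear over k but not over k[t]. The
  construction can then be iterated.\<close>

lemma lie_algebra_poly: "lie_algebra (poly_scale scale) (poly_br br)"
proof
  show "bilinear_op (poly_scale scale) (poly_br br)"
    unfolding bilinear_op_iff vector_space_def
    by (auto intro!: poly_eqI simp: poly_br_add_left poly_br_add_right coeff_poly_br
        br_scale_left br_scale_right scale_sum_right scale_right_distrib scale_left_distrib)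
next
  show "poly_br br f f = 0" for f
    by (rule poly_br_self)
next
  show "poly_br br f (poly_br br g h) + poly_br br g (poly_br br h f) + poly_br br h (poly_br br f g) = 0"
    for f g h
    by (rule poly_br_jacobi)
qed (rule poly_eqI, simp add: scale_right_distrib scale_left_distrib)+

lemma poly_diff_pCons: "poly_diff scale (pCons a f) = f + pCons 0 (poly_diff scale f)"
  by (rule poly_eqI) (auto simp: coeff_pCons scale_left_distrib split: nat.splits)

text \<open>Induction on the left factor: the derivative of a + t f is f + t f', and bracketing with
  a constant commutes with d/dt.\<close>

lemma lie_derivation_poly_diff:
  "lie_derivation (poly_scale scale) (poly_br br) (poly_diff scale)"
proof -
  have add: "poly_diff scale (f + g) = poly_diff scale f + poly_diff scale g" for f g
    by (rule poly_eqI) (simp add: scale_right_distrib)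
  have const: "poly_diff scale (poly_br br [:a:] g) = poly_br br [:a:] (poly_diff scale g)" for a g
    by (rule poly_eqI) (simp add: coeff_poly_br_const br_scale_right)
  have "poly_diff scale (poly_br br f g) = poly_br br (poly_diff scale f) g + poly_br br f (poly_diff scale g)"
    for f g
  proof (induction f)
    case 0
    have "poly_diff scale 0 = 0"
      by (rule poly_eqI) simp
    then show ?case by simp
  next
    case (pCons a f)
    have "poly_diff scale (poly_br br (pCons a f) g) =
        poly_br br [:a:] (poly_diff scale g) + (poly_br br f g + pCons 0 (poly_diff scale (poly_br br f g)))"
      by (simp add: poly_br_pCons_left[of a f] add const poly_diff_pCons)
    also have "\<dots> = poly_br br (f + pCons 0 (poly_diff scale f)) g +
        (poly_br br [:a:] (poly_diff scale g) + pCons 0 (poly_br br f (poly_diff scale g)))"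
      using pCons by (simp add: poly_br_add_left)
    finally show ?case
      by (simp add: poly_br_pCons_left[of a f "poly_diff scale g"] poly_diff_pCons)
  qed
  then show ?thesis
    by (auto simp: lie_derivation_def add intro!: poly_eqI)
qed

lemma lie_derivation_map_poly:
  assumes "lie_derivation scale br d"
  shows "lie_derivation (poly_scale scale) (poly_br br) (map_poly d)"
proof -
  have add: "d (x + y) = d x + d y" for x y
    using assms by (simp add: lie_derivation_def)
  have [simp]: "d 0 = 0"
    by (rule additive_zero) (rule add)
  show ?thesis
    using assms unfolding lie_derivation_def
    by (auto intro!: poly_eqI simp: coeff_map_poly coeff_poly_br additive_sum[of d, OF add] sum.distrib)
qed

lemma degree_poly_br_le: "degree (poly_br br f g) \<le> degree f + degree g"
proof (rule degree_le, safe)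
  fix n assume n: "n > degree f + degree g"
  have "br (coeff f i) (coeff g (n - i)) = 0" for i
    using n by (cases "i > degree f") (simp_all add: coeff_eq_0)
  then show "coeff (poly_br br f g) n = 0"
    by (simp add: coeff_poly_br)
qed

text \<open>Specialisation at t = 1 carries identities of L[t] back to L.\<close>

lemma lie_hom_poly_eval1: "lie_hom (poly_scale scale) (poly_br br) scale br poly_eval1"
proof -
  have const: "poly_eval1 (poly_br br [:a:] g) = br a (poly_eval1 g)" for a g
    by (induction g) (simp_all add: br_add_right)
  have "poly_eval1 (poly_br br f g) = br (poly_eval1 f) (poly_eval1 g)" for f g
  proof (induction f)
    case (pCons a f)
    then show ?case
      unfolding poly_br_pCons_left[of a f] by (simp add: poly_eval1_add const br_add_left)
  qed simp
  moreover have "poly_eval1 (poly_scale scale c f) = scale c (poly_eval1 f)" for c f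
    by (simp add: poly_eval1_altdef[OF degree_poly_scale_le] poly_eval1_def[of f] scale_sum_right)
  ultimately show ?thesis
    by (simp add: lie_hom_def poly_eval1_add)
qed

text \<open>Specialisation at t = 0, used to determine constants of integration.\<close>

lemma lie_hom_coeff_0: "lie_hom (poly_scale scale) (poly_br br) scale br (\<lambda>f. coeff f 0)"
  by (simp add: lie_hom_def coeff_poly_br)

lemma coeff_poly_br_linear:
  "coeff (poly_br br [:y, x:] q) 0 = br y (coeff q 0)"
  "coeff (poly_br br [:y, x:] q) (Suc n) = br y (coeff q (Suc n)) + br x (coeff q n)"
  unfolding poly_br_pCons_left[of y "[:x:]"] by (simp_all add: coeff_poly_br_const)


section \<open>Powers of ad in L and L[t]\<close>

lemma ad_pow_add: "(br z ^^ m) (x + y) = (br z ^^ m) x + (br z ^^ m) y"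
  by (induction m) (simp_all add: br_add_right)

lemma ad_pow_zero [simp]: "(br z ^^ m) 0 = 0"
  by (induction m) simp_all

lemma ad_pow_minus: "(br z ^^ m) (- x) = - (br z ^^ m) x"
  by (rule additive_minus) (rule ad_pow_add)

lemma ad_pow_scale: "(br (scale c z) ^^ m) (scale c x) = scale (c ^ Suc m) ((br z ^^ m) x)"
  by (induction m) (simp_all add: br_scale_left br_scale_right)

lemma degree_poly_br_pow_le: "degree ((poly_br br f ^^ m) g) \<le> m * degree f + degree g"
proof (induction m)
  case (Suc m)
  then show ?case
    using degree_poly_br_le[of f "(poly_br br f ^^ m) g"] by simp
qed simp

lemma coeff_0_poly_br_pow: "coeff ((poly_br br [:y, x:] ^^ m) [:v, u:]) 0 = (br y ^^ m) v"
  by (induction m) (simp_all add: coeff_poly_br_linear)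

text \<open>The top coefficient takes t from every factor, so only x and u survive, just as the
  constant coefficient sees only y and v.\<close>

lemma coeff_Suc_poly_br_pow: "coeff ((poly_br br [:y, x:] ^^ m) [:v, u:]) (Suc m) = (br x ^^ m) u"
proof (induction m)
  case (Suc m)
  \<comment> \<open>The degree is at most m + 1, so bracketing with y contributes nothing to the
    coefficient of t^(m + 2).\<close>
  have "degree ((poly_br br [:y, x:] ^^ m) [:v, u:]) \<le> m * degree [:y, x:] + degree [:v, u:]"
    by (rule degree_poly_br_pow_le)
  also have "\<dots> \<le> m * 1 + 1"
    by (intro add_mono mult_le_mono2) simp_all
  finally show ?case
    using Suc by (simp add: coeff_poly_br_linear coeff_eq_0)
qed simp

end

text \<open>The sum over \<open>i < m\<close> of \<open>(ad z)\<^sup>i (ad u) (ad z)\<^bsup>m - 1 - i\<^esup> v\<close>.\<close>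
primrec ad_insert :: "('g::ab_group_add \<Rightarrow> 'g \<Rightarrow> 'g) \<Rightarrow> 'g \<Rightarrow> 'g \<Rightarrow> 'g \<Rightarrow> nat \<Rightarrow> 'g" where
  "ad_insert b z u v 0 = 0"
| "ad_insert b z u v (Suc m) = b u ((b z ^^ m) v) + b z (ad_insert b z u v m)"

text \<open>In a restricted Lie algebra this is the defect of additivity of the p-map. It is defined
  without one, so it makes sense in L[t] and in h.\<close>

definition jacobson_sum ::
    "('k::field \<Rightarrow> 'g::ab_group_add \<Rightarrow> 'g) \<Rightarrow> ('g \<Rightarrow> 'g \<Rightarrow> 'g) \<Rightarrow> nat \<Rightarrow> 'g \<Rightarrow> 'g \<Rightarrow> 'g" where
  "jacobson_sum s b p x y = (\<Sum>i=1..p-1. jacobson_s s b p i x y)"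

lemma lie_hom_ad_pow:
  assumes "lie_hom s b s' b' h"
  shows "h ((b z ^^ m) v) = (b' (h z) ^^ m) (h v)"
  using assms by (induction m) (simp_all add: lie_hom_def)

lemma lie_hom_map_poly:
  assumes "lie_algebra s b" and "lie_algebra s' b'" and h: "lie_hom s b s' b' h"
  shows "lie_hom (poly_scale s) (poly_br b) (poly_scale s') (poly_br b') (map_poly h)"
proof -
  interpret A: lie_algebra s b by fact
  interpret B: lie_algebra s' b' by fact
  have add: "h (x + y) = h x + h y" for x y
    using h by (simp add: lie_hom_def)
  have [simp]: "h 0 = 0"
    by (rule additive_zero) (rule add)
  show ?thesis
    using h unfolding lie_hom_def
    by (auto intro!: poly_eqI simp: coeff_map_poly A.coeff_poly_br B.coeff_poly_br
        additive_sum[of h, OF add])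
qed

text \<open>Only brackets, sums and scalars enter S, and \<open>map_poly h\<close> sends t x + y to
  t h(x) + h(y).\<close>

lemma lie_hom_jacobson_sum:
  assumes "lie_algebra s b" and "lie_algebra s' b'" and h: "lie_hom s b s' b' h"
  shows "h (jacobson_sum s b p x y) = jacobson_sum s' b' p (h x) (h y)"
proof -
  have add: "h (x + y) = h x + h y" and scale: "h (s c x) = s' c (h x)" for c x y
    using h by (simp_all add: lie_hom_def)
  have h0: "h 0 = 0"
    by (rule additive_zero) (rule add)
  have "h (coeff ((poly_br b [:y, x:] ^^ (p - 1)) [:x:]) j) =
      coeff ((poly_br b' [:h y, h x:] ^^ (p - 1)) [:h x:]) j" for j
    using arg_cong[OF lie_hom_ad_pow[OF lie_hom_map_poly[OF assms], where z = "[:y, x:]" and m = "p - 1" and v = "[:x:]"],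
        of "\<lambda>f. coeff f j"] h0
    by (simp add: coeff_map_poly map_poly_pCons)
  then show ?thesis
    by (simp add: jacobson_sum_def jacobson_s_def additive_sum[of h, OF add] scale)
qed

context lie_algebra
begin

text \<open>The commutator of d with ad z is ad (d z): d hits one of the m factors, collected by
  \<open>ad_insert\<close>, or the argument.\<close>

lemma derivation_ad_pow:
  assumes "lie_derivation scale br d"
  shows "d ((br z ^^ m) v) = ad_insert br z (d z) v m + (br z ^^ m) (d v)"
  using assms by (induction m) (simp_all add: lie_derivation_def br_add_right)

text \<open>Pushing the outer ad z through the bracket by the Leibniz rule turns the induction step
  into Pascal's rule.\<close>

lemma ad_insert_binomial:
  "ad_insert br z u v m =
     (\<Sum>k<m. scale (of_nat (m choose Suc k)) (br ((br z ^^ k) u) ((br z ^^ (m - Suc k)) v)))"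
proof (induction m)
  case (Suc m)
  let ?b = "\<lambda>k. br ((br z ^^ k) u) ((br z ^^ (m - k)) v)"
  have "br z (ad_insert br z u v m) =
      (\<Sum>k<m. scale (of_nat (m choose Suc k)) (?b (Suc k))) + (\<Sum>k<m. scale (of_nat (m choose Suc k)) (?b k))"
  proof -
    have "br z (br ((br z ^^ k) u) ((br z ^^ (m - Suc k)) v)) = ?b (Suc k) + ?b k" if "k < m" for k
      using br_jacobi_derivation[of z "(br z ^^ k) u" "(br z ^^ (m - Suc k)) v"] that
        funpow.simps(2)[of "m - Suc k" "br z"] by (simp add: Suc_diff_Suc)
    then show ?thesis
      by (simp add: Suc br_sum_right br_scale_right scale_right_distrib sum.distrib)
  qed
  moreover have "(\<Sum>k<Suc m. scale (of_nat (m choose k)) (?b k)) =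
      br u ((br z ^^ m) v) + (\<Sum>k<m. scale (of_nat (m choose Suc k)) (?b (Suc k)))"
    by (simp add: sum.lessThan_Suc_shift del: sum.lessThan_Suc)
  moreover have "(\<Sum>k<Suc m. scale (of_nat (Suc m choose Suc k)) (?b k)) =
      (\<Sum>k<Suc m. scale (of_nat (m choose k)) (?b k)) + (\<Sum>k<Suc m. scale (of_nat (m choose Suc k)) (?b k))"
    by (simp add: scale_left_distrib sum.distrib del: sum.lessThan_Suc)
  ultimately show ?case
    by (simp add: ac_simps binomial_eq_0)
qed simp

end

section \<open>The closed one-form and Jacobson's formula in characteristic p\<close>

locale lie_algebra_char_p = lie_algebra scale br
  for scale :: "'k::field \<Rightarrow> 'g::ab_group_add \<Rightarrow> 'g" and br :: "'g \<Rightarrow> 'g \<Rightarrow> 'g" +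
  fixes p :: nat
  assumes char_eq: "CHAR('k) = p" and char_pos: "p > 0"
begin

lemma prime_p: "prime p"
  using prime_CHAR_semidom[where 'a = 'k] char_eq char_pos by simp

lemma of_nat_eq_0_iff: "of_nat n = (0 :: 'k) \<longleftrightarrow> p dvd n"
  using of_nat_eq_0_iff_char_dvd[where 'a = 'k, of n] char_eq by simp

lemma of_nat_neq_0: "0 < n \<Longrightarrow> n < p \<Longrightarrow> of_nat n \<noteq> (0 :: 'k)"
  by (simp add: of_nat_eq_0_iff nat_dvd_not_less)

lemma lie_algebra_char_p_poly: "lie_algebra_char_p (poly_scale scale) (poly_br br) p"
  using lie_algebra_poly char_eq char_pos
  by (simp add: lie_algebra_char_p_def lie_algebra_char_p_axioms_def)

text \<open>As p is prime, p - 1 is positive, so at least one ad z reaches v.\<close>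

lemma ad_pow_pred_eq_0:
  assumes "br z v = 0"
  shows "(br z ^^ (p - 1)) v = 0"
proof -
  obtain k where k: "p - 1 = Suc k"
    using prime_gt_1_nat[OF prime_p] by (cases "p - 1") auto
  show ?thesis
    unfolding k funpow_Suc_right by (simp add: assms)
qed

text \<open>Let m = p - 1. Reversing the summation and swapping the bracket gives the right side the
  coefficients -(m choose k). The difference has coefficients (m choose k+1) + (m choose k) = (p
  choose k+1), all divisible by p.\<close>

lemma ad_insert_symmetric: "ad_insert br z u v (p - 1) = ad_insert br z v u (p - 1)"
proof -
  define m where "m = p - 1"
  have p: "p = Suc m"
    using char_pos by (simp add: m_def)
  let ?b = "\<lambda>k. br ((br z ^^ k) u) ((br z ^^ (m - Suc k)) v)"
  have "ad_insert br z v u m =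
      (\<Sum>k<m. scale (of_nat (m choose Suc (m - Suc k)))
         (br ((br z ^^ (m - Suc k)) v) ((br z ^^ (m - Suc (m - Suc k))) u)))"
    unfolding ad_insert_binomial by (rule sum.nat_diff_reindex[symmetric])
  also have "\<dots> = (\<Sum>k<m. - scale (of_nat (m choose k)) (?b k))"
  proof (intro sum.cong refl)
    fix k assume "k \<in> {..<m}"
    then have "Suc (m - Suc k) = m - k" "m - Suc (m - Suc k) = k" "m choose (m - k) = m choose k"
      by (auto simp flip: binomial_symmetric)
    then show "scale (of_nat (m choose Suc (m - Suc k)))
        (br ((br z ^^ (m - Suc k)) v) ((br z ^^ (m - Suc (m - Suc k))) u)) = - scale (of_nat (m choose k)) (?b k)"
      using br_anticomm[of "(br z ^^ (m - Suc k)) v" "(br z ^^ k) u"] by simp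
  qed
  finally have "ad_insert br z u v m - ad_insert br z v u m =
      (\<Sum>k<m. scale (of_nat (p choose Suc k)) (?b k))"
    by (simp add: ad_insert_binomial p sum_negf scale_left_distrib sum.distrib)
  also have "\<dots> = 0"
  proof (intro sum.neutral ballI)
    fix k assume "k \<in> {..<m}"
    then have "p dvd (p choose Suc k)"
      using prime_p by (intro dvd_choose_prime) (auto simp: p)
    then show "scale (of_nat (p choose Suc k)) (?b k) = 0"
      using of_nat_eq_0_iff by (metis scale_zero_left)
  qed
  finally show ?thesis
    by (simp add: m_def)
qed

text \<open>Closedness of omega: after \<open>derivation_ad_pow\<close> the inserted terms agree by
  symmetry, the others by d (e z) = e (d z).\<close>

lemma derivations_ad_pow_commute:
  assumes "lie_derivation scale br d" and "lie_derivation scale br e" and "d (e z) = e (d z)"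
  shows "d ((br z ^^ (p - 1)) (e z)) = e ((br z ^^ (p - 1)) (d z))"
  using assms ad_insert_symmetric[of z "d z" "e z"] by (simp add: derivation_ad_pow)

lemma poly_diff_zero [simp]: "poly_diff scale 0 = 0"
  by (rule poly_eqI) simp

theorem derivation_jacobson_sum:
  assumes d: "lie_derivation scale br d"
  shows "d (jacobson_sum scale br p x y) =
    (br (x + y) ^^ (p - 1)) (d x + d y) - (br x ^^ (p - 1)) (d x) - (br y ^^ (p - 1)) (d y)"
proof -
  interpret P: lie_algebra_char_p "poly_scale scale" "poly_br br" p
    by (rule lie_algebra_char_p_poly)
  let ?Q = "\<lambda>w. (poly_br br [:y, x:] ^^ (p - 1)) w"
  have add: "d (u + v) = d u + d v" and scale: "d (scale c u) = scale c (d u)" for c u v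
    using d by (simp_all add: lie_derivation_def)
  have d0: "d 0 = 0"
    by (rule additive_zero) (rule add)
  have dpoly: "map_poly d [:y, x:] = [:d y, d x:]" "poly_diff scale [:y, x:] = [:x:]"
      "map_poly d [:x:] = [:d x:]" "poly_diff scale [:d y, d x:] = [:d x:]"
    by (simp_all add: map_poly_pCons d0 poly_diff_pCons)
  \<comment> \<open>Closedness in L[t] at z = t x + y, for d acting on coefficients and d/dt: the
    latter sends z to x, the former to t d(x) + d(y).\<close>
  have Q: "map_poly d (?Q [:x:]) = poly_diff scale (?Q [:d y, d x:])"
    using P.derivations_ad_pow_commute[OF lie_derivation_map_poly[OF d] lie_derivation_poly_diff,
        of "[:y, x:]"] by (simp only: dpoly)
  have "d (jacobson_s scale br p i x y) = coeff (?Q [:d y, d x:]) i" if i: "i \<in> {1..p-1}" for i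
  proof -
    obtain j where j: "i = Suc j"
      using i by (cases i) auto
    \<comment> \<open>Differentiation produces the factor i, which cancels the 1/i in Jacobson's
      s_i.\<close>
    have "d (coeff (?Q [:x:]) j) = scale (of_nat i) (coeff (?Q [:d y, d x:]) i)"
      using arg_cong[OF Q, of "\<lambda>f. coeff f j"] by (simp add: coeff_map_poly d0 j)
    moreover have "of_nat i \<noteq> (0 :: 'k)"
      using i by (intro of_nat_neq_0) auto
    ultimately show ?thesis
      by (simp add: jacobson_s_def scale j del: of_nat_Suc)
  qed
  then have dS: "d (jacobson_sum scale br p x y) = (\<Sum>i=1..p-1. coeff (?Q [:d y, d x:]) i)"
    by (simp add: jacobson_sum_def additive_sum[of d, OF add])
  obtain m where m: "p = Suc m"
    using char_pos by (cases p) auto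
  \<comment> \<open>With degree at most p, evaluation at t = 1 adds the coefficients 0 to p. Those
    at 0 and p are the two terms subtracted in the claim.\<close>
  have "degree (?Q [:d y, d x:]) \<le> (p - 1) * degree [:y, x:] + degree [:d y, d x:]"
    by (rule degree_poly_br_pow_le)
  also have "\<dots> \<le> (p - 1) * 1 + 1"
    by (intro add_mono mult_le_mono2) simp_all
  finally have "poly_eval1 (?Q [:d y, d x:]) = (\<Sum>i\<le>p. coeff (?Q [:d y, d x:]) i)"
    using char_pos by (intro poly_eval1_altdef) simp
  also have "{..p} = insert 0 (insert p {1..p-1})"
    using char_pos by auto
  also have "(\<Sum>i\<in>\<dots>. coeff (?Q [:d y, d x:]) i) =
      (br y ^^ (p - 1)) (d y) + ((br x ^^ (p - 1)) (d x) + (\<Sum>i=1..p-1. coeff (?Q [:d y, d x:]) i))"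
    using char_pos by (simp add: m coeff_0_poly_br_pow coeff_Suc_poly_br_pow)
  finally show ?thesis
    unfolding dS lie_hom_ad_pow[OF lie_hom_poly_eval1] by (simp add: algebra_simps)
qed

text \<open>The case d = ad w; both sides change sign when w is moved to the right of the
  bracket.\<close>

corollary ad_jacobson_sum:
  "br (jacobson_sum scale br p x y) w = (br (x + y) ^^ p) w - (br x ^^ p) w - (br y ^^ p) w"
proof -
  have pow: "(br z ^^ (p - 1)) (br w z) = - (br z ^^ p) w" for z
  proof -
    obtain m where m: "p = Suc m"
      using char_pos by (cases p) auto
    show ?thesis
      unfolding m funpow_Suc_right using br_anticomm[of w z] by (simp add: ad_pow_minus)
  qed
  have "br (jacobson_sum scale br p x y) w = - br w (jacobson_sum scale br p x y)"
    by (rule br_anticomm)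
  then show ?thesis
    unfolding derivation_jacobson_sum[OF lie_derivation_br] br_add_right[of w x y, symmetric] pow
    by simp
qed

section \<open>S as a symmetric 2-cocycle\<close>

lemma jacobson_sum_zero_left: "jacobson_sum scale br p 0 y = 0"
proof -
  interpret P: lie_algebra_char_p "poly_scale scale" "poly_br br" p
    by (rule lie_algebra_char_p_poly)
  show ?thesis
    by (simp add: jacobson_sum_def jacobson_s_def)
qed

lemma jacobson_sum_zero_right: "jacobson_sum scale br p x 0 = 0"
proof -
  interpret P: lie_algebra_char_p "poly_scale scale" "poly_br br" p
    by (rule lie_algebra_char_p_poly)
  have "(poly_br br [:0, x:] ^^ (p - 1)) [:x:] = 0"
    by (rule P.ad_pow_pred_eq_0) (simp add: br_self)
  then show ?thesis
    by (simp add: jacobson_sum_def jacobson_s_def)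
qed

text \<open>Indices strictly between 0 and p are invertible in the field; t^p shows that the degree
  bound matters.\<close>

lemma poly_diff_eq_0_imp:
  assumes "poly_diff scale f = 0" and "degree f < p"
  shows "f = [:coeff f 0:]"
proof (rule poly_eqI)
  fix n
  show "coeff f n = coeff [:coeff f 0:] n"
  proof (cases n)
    case (Suc m)
    have "coeff f (Suc m) = 0"
    proof (cases "Suc m < p")
      case True
      then have "of_nat (Suc m) \<noteq> (0 :: 'k)"
        by (intro of_nat_neq_0) auto
      then show ?thesis
        using arg_cong[OF assms(1), of "\<lambda>f. coeff f m"] by (simp del: of_nat_Suc)
    next
      case False
      then show ?thesis
        using assms(2) by (simp add: coeff_eq_0)
    qed
    then show ?thesis
      by (simp add: Suc)
  qed simp
qed

text \<open>Let s be the outer variable of Jacobson's construction, t the inner one. The coefficient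
  of s^j contains f exactly j + 1 times, so its degree in t is at most j + 1; here j = i - 1 with i
  < p.\<close>

lemma degree_jacobson_sum_poly_left:
  assumes "degree f \<le> 1" and "degree g = 0"
  shows "degree (jacobson_sum (poly_scale scale) (poly_br br) p f g) < p"
proof -
  interpret P: lie_algebra_char_p "poly_scale scale" "poly_br br" p
    by (rule lie_algebra_char_p_poly)
  have "degree (coeff ((poly_br (poly_br br) [:g, f:] ^^ m) [:f:]) j) \<le> Suc j" for m j
  proof (induction m arbitrary: j)
    case 0
    then show ?case
      using assms by (cases j) auto
  next
    case (Suc m)
    let ?q = "\<lambda>j. coeff ((poly_br (poly_br br) [:g, f:] ^^ m) [:f:]) j"
    have g: "degree (poly_br br g (?q j)) \<le> Suc j" for j
      using degree_poly_br_le[of g "?q j"] Suc[of j] assms by simp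
    have f: "degree (poly_br br f (?q j)) \<le> Suc (Suc j)" for j
      using degree_poly_br_le[of f "?q j"] Suc[of j] assms by simp
    show ?case
      using g[of 0] degree_add_le[OF g f] by (cases j) (simp_all add: P.coeff_poly_br_linear)
  qed
  then have "degree (jacobson_s (poly_scale scale) (poly_br br) p i f g) \<le> p - 1"
    if "i \<in> {1..p-1}" for i
    unfolding jacobson_s_def using that degree_poly_scale_le le_trans
    by (metis (no_types, lifting) Suc_diff_1 atLeastAtMost_iff less_eq_Suc_le One_nat_def)
  then have "degree (jacobson_sum (poly_scale scale) (poly_br br) p f g) \<le> p - 1"
    unfolding jacobson_sum_def by (intro degree_sum_le) auto
  then show ?thesis
    using char_pos by linarith
qed

text \<open>Each of the p - 1 brackets raises the inner degree by at most one, starting from the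
  constant f.\<close>

lemma degree_jacobson_sum_poly_right:
  assumes "degree f = 0" and "degree g \<le> 1"
  shows "degree (jacobson_sum (poly_scale scale) (poly_br br) p f g) < p"
proof -
  interpret P: lie_algebra_char_p "poly_scale scale" "poly_br br" p
    by (rule lie_algebra_char_p_poly)
  have "degree (coeff ((poly_br (poly_br br) [:g, f:] ^^ m) [:f:]) j) \<le> m" for m j
  proof (induction m arbitrary: j)
    case 0
    then show ?case
      using assms by (cases j) auto
  next
    case (Suc m)
    let ?q = "\<lambda>j. coeff ((poly_br (poly_br br) [:g, f:] ^^ m) [:f:]) j"
    have g: "degree (poly_br br g (?q j)) \<le> Suc m" for j
      using degree_poly_br_le[of g "?q j"] Suc[of j] assms by simp
    have f: "degree (poly_br br f (?q j)) \<le> Suc m" for j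
      using degree_poly_br_le[of f "?q j"] Suc[of j] assms by simp
    show ?case
      using g[of 0] degree_add_le[OF g f] by (cases j) (simp_all add: P.coeff_poly_br_linear)
  qed
  then have "degree (jacobson_s (poly_scale scale) (poly_br br) p i f g) \<le> p - 1" for i
    unfolding jacobson_s_def using degree_poly_scale_le le_trans by blast
  then have "degree (jacobson_sum (poly_scale scale) (poly_br br) p f g) \<le> p - 1"
    unfolding jacobson_sum_def by (intro degree_sum_le) auto
  then show ?thesis
    using char_pos by linarith
qed

text \<open>With t x for x, both sides have the same derivative and vanish at t = 0. Their degrees
  are below p, so they agree, and t = 1 gives the claim.\<close>

theorem jacobson_sum_commute: "jacobson_sum scale br p x y = jacobson_sum scale br p y x"
proof -
  interpret P: lie_algebra_char_p "poly_scale scale" "poly_br br" p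
    by (rule lie_algebra_char_p_poly)
  let ?S = "jacobson_sum (poly_scale scale) (poly_br br) p"
  define F where "F = ?S [:0, x:] [:y:] - ?S [:y:] [:0, x:]"
  have diff: "poly_diff scale (f - g) = poly_diff scale f - poly_diff scale g" for f g
    by (rule poly_eqI) (simp add: scale_right_diff_distrib)
  have "poly_diff scale F = 0"
    using P.ad_pow_pred_eq_0[of "[:0, x:]" "[:x:]"]
    by (simp add: F_def diff P.derivation_jacobson_sum[OF lie_derivation_poly_diff] poly_diff_pCons br_self)
  moreover have "degree F < p"
    unfolding F_def
    by (intro degree_diff_less degree_jacobson_sum_poly_left degree_jacobson_sum_poly_right) auto
  ultimately have "F = [:coeff F 0:]"
    by (rule poly_diff_eq_0_imp)
  moreover have "coeff F 0 = 0"
    by (simp add: F_def jacobson_sum_zero_left jacobson_sum_zero_right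
        lie_hom_jacobson_sum[OF P.lie_algebra_axioms lie_algebra_axioms lie_hom_coeff_0])
  ultimately have "F = 0"
    by simp
  then have "?S [:0, x:] [:y:] = ?S [:y:] [:0, x:]"
    by (simp add: F_def)
  from arg_cong[OF this, of poly_eval1] show ?thesis
    by (simp add: lie_hom_jacobson_sum[OF P.lie_algebra_axioms lie_algebra_axioms lie_hom_poly_eval1])
qed

text \<open>With t x for x, both sides have derivative omega (t x + y + z) x, the terms omega (t x +
  y) x cancelling on the left, and both equal S y z at t = 0.\<close>

theorem jacobson_sum_cocycle:
  "jacobson_sum scale br p x y + jacobson_sum scale br p (x + y) z =
   jacobson_sum scale br p y z + jacobson_sum scale br p x (y + z)"
proof -
  interpret P: lie_algebra_char_p "poly_scale scale" "poly_br br" p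
    by (rule lie_algebra_char_p_poly)
  let ?S = "jacobson_sum (poly_scale scale) (poly_br br) p"
  define F where "F = ?S [:0, x:] [:y:] + ?S [:y, x:] [:z:] - ?S [:y:] [:z:] - ?S [:0, x:] [:y + z:]"
  have diff: "poly_diff scale (f - g) = poly_diff scale f - poly_diff scale g" for f g
    by (rule poly_eqI) (simp add: scale_right_diff_distrib)
  have add: "poly_diff scale (f + g) = poly_diff scale f + poly_diff scale g" for f g
    by (rule poly_eqI) (simp add: scale_right_distrib)
  have "poly_diff scale F = 0"
    using P.ad_pow_pred_eq_0[of "[:0, x:]" "[:x:]"]
    by (simp add: F_def diff add P.derivation_jacobson_sum[OF lie_derivation_poly_diff] poly_diff_pCons br_self)
  moreover have "degree F < p"
    unfolding F_def
    by (intro degree_diff_less degree_add_less degree_jacobson_sum_poly_left) auto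
  ultimately have "F = [:coeff F 0:]"
    by (rule poly_diff_eq_0_imp)
  moreover have "coeff F 0 = 0"
    by (simp add: F_def jacobson_sum_zero_left
        lie_hom_jacobson_sum[OF P.lie_algebra_axioms lie_algebra_axioms lie_hom_coeff_0])
  ultimately have "F = 0"
    by simp
  then have "?S [:0, x:] [:y:] + ?S [:y, x:] [:z:] = ?S [:y:] [:z:] + ?S [:0, x:] [:y + z:]"
    by (simp add: F_def algebra_simps)
  from arg_cong[OF this, of poly_eval1] show ?thesis
    by (simp add: poly_eval1_add add.commute
        lie_hom_jacobson_sum[OF P.lie_algebra_axioms lie_algebra_axioms lie_hom_poly_eval1])
qed

text \<open>Each s_i is homogeneous of degree p: p - 1 brackets and the initial vector.\<close>

lemma jacobson_sum_scale:
  "jacobson_sum scale br p (scale c x) (scale c y) = scale (c ^ p) (jacobson_sum scale br p x y)"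
proof -
  interpret P: lie_algebra_char_p "poly_scale scale" "poly_br br" p
    by (rule lie_algebra_char_p_poly)
  have poly: "[:scale c y, scale c x:] = poly_scale scale c [:y, x:]" "[:scale c x:] = poly_scale scale c [:x:]"
    by (simp_all add: poly_scale_def map_poly_pCons)
  have "jacobson_s scale br p i (scale c x) (scale c y) = scale (c ^ p) (jacobson_s scale br p i x y)" for i
    unfolding jacobson_s_def poly(1) unfolding poly(2) P.ad_pow_scale using char_pos by (simp add: mult.commute)
  then show ?thesis
    by (simp add: jacobson_sum_def scale_sum_right)
qed

text \<open>A symmetric 2-cocycle gives a sum of four elements a total defect independent of
  grouping: (x + y) + (x' + y') is compared with (x + x') + (y + y').\<close>

lemma jacobson_sum_interchange:
  "jacobson_sum scale br p x y + jacobson_sum scale br p (x + y) (x' + y') =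
   jacobson_sum scale br p x x' + jacobson_sum scale br p y y' +
   jacobson_sum scale br p (x + x') (y + y') - jacobson_sum scale br p x' y'"
proof -
  let ?S = "jacobson_sum scale br p"
  have "?S x (y + (x' + y')) = ?S x x' + ?S (x + x') (y + y') - ?S x' (y + y')"
    unfolding add.left_commute[of y x' y']
    using jacobson_sum_cocycle[of x x' "y + y'"] by (simp add: eq_diff_eq add.commute)
  moreover have "?S y (x' + y') = ?S y y' + ?S x' (y + y') - ?S x' y'"
    using jacobson_sum_cocycle[of y y' x'] jacobson_sum_commute[of x' "y + y'"]
      jacobson_sum_commute[of x' y'] by (simp add: eq_diff_eq add.commute)
  ultimately show ?thesis
    using jacobson_sum_cocycle[of x y "x' + y'"] by simp
qed

lemma of_nat_fact_neq_0: "m < p \<Longrightarrow> of_nat (fact m) \<noteq> (0 :: 'k)"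
  unfolding of_nat_eq_0_iff prime_dvd_fact_iff[OF prime_p] by simp

end

section \<open>Compositions and the expansion of (t ad x + D)^k x\<close>

lemma compositions_0_right: "compositions m 0 = (if m = 0 then {[]} else {})"
  by (auto simp: compositions_def)

lemma compositions_0_left: "compositions 0 (Suc n) = {}"
  by (auto simp: compositions_def length_Suc_conv)

lemma finite_compositions: "finite (compositions m n)"
proof (rule finite_subset)
  show "compositions m n \<subseteq> {ls. set ls \<subseteq> {..m} \<and> length ls = n}"
    by (auto simp: compositions_def intro: member_le_sum_list)
qed (simp add: finite_lists_length_eq)

lemma sum_compositions_snoc:
  "(\<Sum>ls\<in>compositions (Suc m) (Suc n). F ls) =
   (\<Sum>j\<le>m. \<Sum>ls\<in>compositions (m - j) n. F (ls @ [Suc j]))"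
proof -
  have "(\<Sum>j\<le>m. \<Sum>ls\<in>compositions (m - j) n. F (ls @ [Suc j])) =
      (\<Sum>(j, ls)\<in>(SIGMA j:{..m}. compositions (m - j) n). F (ls @ [Suc j]))"
    by (rule sum.Sigma) (simp_all add: finite_compositions)
  also have "\<dots> = (\<Sum>ls\<in>compositions (Suc m) (Suc n). F ls)"
  proof (rule sum.reindex_bij_witness[of _ "\<lambda>ls. (last ls - 1, butlast ls)" "\<lambda>(j, ls). ls @ [Suc j]"])
    fix ls assume "ls \<in> compositions (Suc m) (Suc n)"
    then obtain ks l where ls: "ls = ks @ [l]" "length ks = n" "sum_list ks + l = Suc m" "l \<ge> 1"
        "\<forall>k\<in>set ks. k \<ge> 1"
      by (cases ls rule: rev_cases) (auto simp: compositions_def)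
    then show "(last ls - 1, butlast ls) \<in> (SIGMA j:{..m}. compositions (m - j) n)"
      and "(case (last ls - 1, butlast ls) of (j, ls) \<Rightarrow> ls @ [Suc j]) = ls"
      by (auto simp: compositions_def)
  qed (auto simp: compositions_def)
  finally show ?thesis ..
qed

lemma sum_pascal:
  fixes h :: "nat \<Rightarrow> 'g::ab_group_add" and s :: "'k::field \<Rightarrow> 'g \<Rightarrow> 'g"
  assumes "vector_space s"
  shows "(\<Sum>j\<le>Suc m. s (of_nat (Suc m choose j)) (h j)) =
    (\<Sum>j\<le>m. s (of_nat (m choose j)) (h j)) + (\<Sum>j\<le>m. s (of_nat (m choose j)) (h (Suc j)))"
proof -
  interpret vector_space s by fact
  have "(\<Sum>j\<le>Suc m. s (of_nat (Suc m choose j)) (h j)) =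
      h 0 + (\<Sum>j\<le>m. s (of_nat (m choose Suc j)) (h (Suc j))) + (\<Sum>j\<le>m. s (of_nat (m choose j)) (h (Suc j)))"
    by (simp add: sum.atMost_Suc_shift scale_left_distrib sum.distrib add.assoc add.commute del: sum.atMost_Suc)
  also have "h 0 + (\<Sum>j\<le>m. s (of_nat (m choose Suc j)) (h (Suc j))) =
      (\<Sum>j\<le>Suc m. s (of_nat (m choose j)) (h j))"
    by (simp add: sum.atMost_Suc_shift del: sum.atMost_Suc)
  also have "\<dots> = (\<Sum>j\<le>m. s (of_nat (m choose j)) (h j))"
    by (simp add: binomial_eq_0)
  finally show ?thesis .
qed

text \<open>All entries but the last become iterated ad operators, matching
  \<open>composition_op\<close>, which acts on a vector.\<close>

lemma nested_br_snoc:
  "nested_br b (map f (ls @ [l])) = foldr (\<lambda>k. b (f k)) ls (f l)"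
proof (induction ls)
  case (Cons k ls)
  then show ?case by (cases ls) simp_all
qed simp

text \<open>With \<open>a j = D\<^sup>j x\<close> for a derivation \<open>D\<close>, the coefficient of \<open>t\<^sup>n\<close> in \<open>(t ad x + D)\<^sup>k\<close> is the
  sum over \<open>j\<close> of \<open>(k choose j) composition_op n (k - j) \<circ> D\<^sup>j\<close>; applied to \<open>x\<close> this is
  \<open>composition_sum n k a\<close>.  The recursion peels off the last entry of a composition.\<close>
primrec composition_op ::
    "('k::field \<Rightarrow> 'g::ab_group_add \<Rightarrow> 'g) \<Rightarrow> ('g \<Rightarrow> 'g \<Rightarrow> 'g) \<Rightarrow> (nat \<Rightarrow> 'g) \<Rightarrow> nat \<Rightarrow> nat \<Rightarrow> 'g \<Rightarrow> 'g"
where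
  "composition_op s b a 0 m v = (if m = 0 then v else 0)"
| "composition_op s b a (Suc n) m v = (case m of 0 \<Rightarrow> 0
     | Suc k \<Rightarrow> (\<Sum>j\<le>k. s (of_nat (k choose j)) (composition_op s b a n (k - j) (b (a j) v))))"

text \<open>The sequence f is independent of a because the recursion for
  \<open>composition_op\<close> is itself such a sum, with f j = [a j, v].\<close>

definition composition_sum ::
    "('k::field \<Rightarrow> 'g::ab_group_add \<Rightarrow> 'g) \<Rightarrow> ('g \<Rightarrow> 'g \<Rightarrow> 'g) \<Rightarrow> (nat \<Rightarrow> 'g) \<Rightarrow> nat \<Rightarrow> nat \<Rightarrow>
     (nat \<Rightarrow> 'g) \<Rightarrow> 'g"
where
  "composition_sum s b a n k f = (\<Sum>j\<le>k. s (of_nat (k choose j)) (composition_op s b a n (k - j) (f j)))"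

context lie_algebra
begin

lemma composition_op_add:
  "composition_op scale br a n m (u + v) = composition_op scale br a n m u + composition_op scale br a n m v"
  by (induction n arbitrary: m u v)
    (auto simp: br_add_right scale_right_distrib sum.distrib split: nat.splits)

lemma composition_op_zero [simp]: "composition_op scale br a n m 0 = 0"
  by (rule additive_zero) (rule composition_op_add)

text \<open>Hypothesis \<open>op\<close> moves d past each operator. The error term g lets the
  result serve twice: g j = [a j, d v] in the induction on operators, g = 0 for f = a.\<close>

lemma derivation_composition_sum:
  assumes d: "lie_derivation scale br d"
    and f: "\<And>j. d (f j) = f (Suc j) + g j"
    and op: "\<And>m v. d (composition_op scale br a n m v) +
      (case n of 0 \<Rightarrow> 0 | Suc n' \<Rightarrow> br (a 0) (composition_op scale br a n' m v)) =
      composition_op scale br a n (Suc m) v + composition_op scale br a n m (d v)"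
  shows "d (composition_sum scale br a n k f) +
      (case n of 0 \<Rightarrow> 0 | Suc n' \<Rightarrow> br (a 0) (composition_sum scale br a n' k f)) =
      composition_sum scale br a n (Suc k) f + composition_sum scale br a n k g"
proof -
  let ?T = "composition_op scale br a n"
  let ?c = "\<lambda>j. of_nat (k choose j) :: 'k"
  have add: "d (x + y) = d x + d y" and scale: "d (scale c x) = scale c (d x)" for c x y
    using d by (simp_all add: lie_derivation_def)
  have "d (composition_sum scale br a n k f) +
      (case n of 0 \<Rightarrow> 0 | Suc n' \<Rightarrow> br (a 0) (composition_sum scale br a n' k f)) =
      (\<Sum>j\<le>k. scale (?c j) (d (?T (k - j) (f j)) +
        (case n of 0 \<Rightarrow> 0 | Suc n' \<Rightarrow> br (a 0) (composition_op scale br a n' (k - j) (f j)))))"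
    by (simp add: composition_sum_def additive_sum[of d, OF add] scale br_sum_right br_scale_right
        scale_right_distrib sum.distrib split: nat.splits)
  also have "\<dots> = (\<Sum>j\<le>k. scale (?c j) (?T (Suc k - j) (f j))) +
      (\<Sum>j\<le>k. scale (?c j) (?T (Suc k - Suc j) (f (Suc j)))) + composition_sum scale br a n k g"
    by (simp add: op f composition_op_add composition_sum_def scale_right_distrib sum.distrib Suc_diff_le
        add.assoc)
  \<comment> \<open>Pascal's rule merges the terms in f j and f (j + 1).\<close>
  also have "\<dots> = composition_sum scale br a n (Suc k) f + composition_sum scale br a n k g"
    unfolding composition_sum_def by (subst sum_pascal[OF vector_space_axioms]) (rule refl)
  finally show ?thesis .
qed

text \<open>If T_m is the sum over n of t^n times \<open>composition_op\<close> n m, this is (t ad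
  (a 0) + d) T_m = T_(m+1) + T_m d, read at t^n.\<close>

lemma derivation_composition_op:
  assumes d: "lie_derivation scale br d" and a: "\<And>j. d (a j) = a (Suc j)"
  shows "d (composition_op scale br a n m v) +
      (case n of 0 \<Rightarrow> 0 | Suc n' \<Rightarrow> br (a 0) (composition_op scale br a n' m v)) =
      composition_op scale br a n (Suc m) v + composition_op scale br a n m (d v)"
proof (induction n arbitrary: m v)
  have "d (x + y) = d x + d y" for x y
    using d by (simp add: lie_derivation_def)
  then have d0: "d 0 = 0"
    by (rule additive_zero)
  {
    case 0
    show ?case by (simp add: d0)
  next
    case (Suc n)
    show ?case
    proof (cases m)
      case 0
      then show ?thesis by (cases n) (simp_all add: d0)
    next
      case (Suc k)
      have f: "d (br (a j) v) = br (a (Suc j)) v + br (a j) (d v)" for j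
        using d by (simp add: lie_derivation_def a)
      have "d (composition_sum scale br a n k (\<lambda>j. br (a j) v)) +
          (case n of 0 \<Rightarrow> 0 | Suc n' \<Rightarrow> br (a 0) (composition_sum scale br a n' k (\<lambda>j. br (a j) v))) =
          composition_sum scale br a n (Suc k) (\<lambda>j. br (a j) v) +
          composition_sum scale br a n k (\<lambda>j. br (a j) (d v))"
        by (rule derivation_composition_sum[where d = d and f = "\<lambda>j. br (a j) v", OF d f Suc.IH])
      then show ?thesis
        by (cases n) (simp_all add: Suc composition_sum_def del: sum.atMost_Suc)
    qed
  }
qed

lemma derivation_composition_sum_self:
  assumes d: "lie_derivation scale br d" and a: "\<And>j. d (a j) = a (Suc j)"
  shows "composition_sum scale br a n (Suc k) a = d (composition_sum scale br a n k a) +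
      (case n of 0 \<Rightarrow> 0 | Suc n' \<Rightarrow> br (a 0) (composition_sum scale br a n' k a))"
  using derivation_composition_sum[where d = d and f = a and g = "\<lambda>_. 0", OF d _
      derivation_composition_op[where d = d and a = a, OF d a]]
    a by (simp add: composition_sum_def)

end

context lie_algebra_char_p
begin

text \<open>Appending an entry to a nonempty list adds the prefix sum m - j, whose inverse cancels
  in m! = (m choose j) j! (m - j) (m - j - 1)!. For j = m the list is empty and no prefix sum is
  added.\<close>

lemma composition_coeff_snoc:
  assumes "ls \<in> compositions (m - j) n" and "j \<le> m" and "m < p"
  shows "(composition_coeff (Suc m) (ls @ [Suc j]) :: 'k) = of_nat (m choose j) * composition_coeff (m - j) ls"
proof (cases "j = m")
  case True
  then have "ls = []"
    using assms(1) by (cases ls) (auto simp: compositions_def)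
  then show ?thesis
    using True of_nat_fact_neq_0[OF assms(3)] by (simp add: composition_coeff_def)
next
  case False
  define s where "s = m - j"
  have s: "s > 0" "s < p" "m - s = j" "s \<le> m"
    using assms False by (auto simp: s_def)
  have ls: "length ls = n" "sum_list ls = s" "ls \<noteq> []"
    using assms(1) s(1) by (auto simp: compositions_def s_def)
  then obtain n' where n': "n = Suc n'"
    by (cases n) auto
  have "(\<Prod>v=1..n. inverse (of_nat (sum_list (take v (ls @ [Suc j])))) :: 'k) =
      (\<Prod>v=1..n-1. inverse (of_nat (sum_list (take v ls)))) * inverse (of_nat s)"
    using ls by (simp add: n')
  moreover have "of_nat (fact m) = (of_nat (m choose j) * of_nat (fact j) * (of_nat s * of_nat (fact (s - 1))) :: 'k)"
  proof -
    have "fact m = (m choose j) * fact j * (s * fact (s - 1))"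
      using binomial_fact_lemma[OF assms(2)] fact_reduce[of s, where 'a = nat] s(1)
      by (simp add: s_def ac_simps)
    then show ?thesis
      by (metis of_nat_mult)
  qed
  moreover have "of_nat (fact j) \<noteq> (0 :: 'k)" "of_nat s \<noteq> (0 :: 'k)"
    using assms(2,3) s by (simp_all add: of_nat_fact_neq_0 of_nat_neq_0 del: of_nat_fact)
  ultimately show ?thesis
    using ls by (simp add: composition_coeff_def field_simps flip: s_def del: of_nat_fact)
qed

lemma composition_op_altdef:
  assumes "m \<le> p"
  shows "composition_op scale br a n m v = (\<Sum>ls\<in>compositions m n.
    scale (composition_coeff m ls) (foldr (\<lambda>l. br (a (l - 1))) ls v))"
  using assms
proof (induction n arbitrary: m v)
  case 0
  \<comment> \<open>Truncated subtraction gives the empty composition of 0 the coefficient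
    1.\<close>
  then show ?case
    by (simp add: compositions_0_right composition_coeff_def)
next
  case (Suc n)
  show ?case
  proof (cases m)
    case 0
    then show ?thesis by (simp add: compositions_0_left)
  next
    case m: (Suc k)
    show ?thesis
      using Suc by (simp add: m sum_compositions_snoc composition_coeff_snoc scale_sum_right)
  qed
qed

text \<open>The index n counts brackets; the innermost argument is one more entry, which explains
  both shifts. For a j = D^j x an entry l contributes D^(l - 1) x.\<close>

lemma composition_sum_altdef:
  assumes "m < p"
  shows "composition_sum scale br a n m a = (\<Sum>ls\<in>compositions (Suc m) (Suc n).
    scale (composition_coeff (Suc m) ls) (nested_br br (map (\<lambda>l. a (l - 1)) ls)))"
  using assms unfolding composition_sum_def sum_compositions_snoc nested_br_snoc
  by (simp add: composition_op_altdef composition_coeff_snoc scale_sum_right)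

end

section \<open>The sub-adjacent Lie algebra and the semidirect product h\<close>

definition pair_scale :: "('k \<Rightarrow> 'g \<Rightarrow> 'g) \<Rightarrow> 'k \<Rightarrow> 'g \<times> 'g \<Rightarrow> 'g \<times> 'g" where
  "pair_scale s c = map_prod (s c) (s c)"

text \<open>The first component is the acting sub-adjacent algebra, the second the ideal with the
  original bracket.\<close>

definition semidirect_br ::
    "('g::ab_group_add \<Rightarrow> 'g \<Rightarrow> 'g) \<Rightarrow> ('g \<Rightarrow> 'g \<Rightarrow> 'g) \<Rightarrow> 'g \<times> 'g \<Rightarrow> 'g \<times> 'g \<Rightarrow> 'g \<times> 'g" where
  "semidirect_br br tr = (\<lambda>(u, x) (v, y). (sub_adjacent br tr u v, br x y + tr u y - tr v x))"

lemma semidirect_br_simp [simp]: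
  "semidirect_br br tr (u, x) (v, y) = (sub_adjacent br tr u v, br x y + tr u y - tr v x)"
  by (simp add: semidirect_br_def)

lemma pair_scale_simp [simp]: "pair_scale s c (u, x) = (s c u, s c x)"
  by (simp add: pair_scale_def)

context post_lie_algebra
begin

lemma tr_add_right: "x \<triangleright> (y + z) = x \<triangleright> y + x \<triangleright> z"
  and tr_add_left: "(x + y) \<triangleright> z = x \<triangleright> z + y \<triangleright> z"
  and tr_scale_right: "x \<triangleright> scale c y = scale c (x \<triangleright> y)"
  and tr_scale_left: "scale c x \<triangleright> y = scale c (x \<triangleright> y)"
  using bilinear_tr by (simp_all add: bilinear_op_iff)

lemma tr_diff_right: "x \<triangleright> (y - z) = x \<triangleright> y - x \<triangleright> z"
  by (rule additive_diff) (rule tr_add_right)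

lemma tr_diff_left: "(x - y) \<triangleright> z = x \<triangleright> z - y \<triangleright> z"
  by (rule additive_diff[of "\<lambda>x. x \<triangleright> z"]) (rule tr_add_left)

lemma tr_zero_right [simp]: "x \<triangleright> 0 = 0"
  by (rule additive_zero) (rule tr_add_right)

lemma tr_zero_left [simp]: "0 \<triangleright> x = 0"
  by (rule additive_zero[of "\<lambda>y. y \<triangleright> x"]) (rule tr_add_left)

lemma tr_br_right: "x \<triangleright> br y z = br y (x \<triangleright> z) - br z (x \<triangleright> y)"
  using br_anticomm[of "x \<triangleright> y" z] by (simp add: tr_br)

lemma sub_adjacent_zero [simp]: "sub_adjacent br (\<triangleright>) 0 x = 0" "sub_adjacent br (\<triangleright>) x 0 = 0"
  by (simp_all add: sub_adjacent_def)

text \<open>The terms x \<triangleright> y - y \<triangleright> x absorb the non-operator parts of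
  the two associators, so the post-Lie product becomes a representation.\<close>

lemma sub_adjacent_tr:
  "sub_adjacent br (\<triangleright>) x y \<triangleright> z = x \<triangleright> (y \<triangleright> z) - y \<triangleright> (x \<triangleright> z)"
  by (simp add: sub_adjacent_def tr_add_left tr_diff_left br_tr)

lemma sub_adjacent_jacobi:
  "sub_adjacent br (\<triangleright>) x (sub_adjacent br (\<triangleright>) y z) + sub_adjacent br (\<triangleright>) y (sub_adjacent br (\<triangleright>) z x) +
   sub_adjacent br (\<triangleright>) z (sub_adjacent br (\<triangleright>) x y) = 0"
  using jacobi[of x y z]
  \<comment> \<open>Only outer brackets are unfolded first, so that inner ones acting from the left
    can be resolved as commutators.\<close>
  by (simp add: sub_adjacent_def[of br _ _ "sub_adjacent _ _ _ _"] sub_adjacent_tr)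
     (simp add: sub_adjacent_def br_add_right br_diff_right tr_add_right tr_diff_right
       tr_br_right algebra_simps)

lemma lie_algebra_sub_adjacent: "lie_algebra scale (sub_adjacent br (\<triangleright>))"
proof
  show "bilinear_op scale (sub_adjacent br (\<triangleright>))"
    unfolding bilinear_op_iff using vector_space_axioms
    by (auto simp: sub_adjacent_def br_add_left br_add_right tr_add_left tr_add_right br_scale_left
        br_scale_right tr_scale_left tr_scale_right scale_right_distrib scale_right_diff_distrib)
qed (auto simp: sub_adjacent_jacobi, simp add: sub_adjacent_def br_self)

lemma semidirect_br_jacobi:
  "semidirect_br br (\<triangleright>) f (semidirect_br br (\<triangleright>) g h) + semidirect_br br (\<triangleright>) g (semidirect_br br (\<triangleright>) h f) +
   semidirect_br br (\<triangleright>) h (semidirect_br br (\<triangleright>) f g) = 0"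
proof -
  obtain u x v y w z where fgh: "f = (u, x)" "g = (v, y)" "h = (w, z)"
    by (metis surj_pair)
  show ?thesis
    using jacobi[of x y z] sub_adjacent_jacobi[of u v w]
    by (simp add: fgh sub_adjacent_tr br_add_right br_diff_right tr_add_right tr_diff_right
        tr_br_right zero_prod_def algebra_simps)
qed

lemma lie_algebra_semidirect: "lie_algebra (pair_scale scale) (semidirect_br br (\<triangleright>))"
proof
  show "bilinear_op (pair_scale scale) (semidirect_br br (\<triangleright>))"
    unfolding bilinear_op_iff vector_space_def
    by (auto simp: sub_adjacent_def br_add_left br_add_right tr_add_left tr_add_right br_scale_left
        br_scale_right tr_scale_left tr_scale_right scale_right_distrib scale_left_distrib
        scale_right_diff_distrib)
  show "semidirect_br br (\<triangleright>) f f = 0" for f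
    by (cases f) (simp add: sub_adjacent_def br_self zero_prod_def)
  show "semidirect_br br (\<triangleright>) f (semidirect_br br (\<triangleright>) g h) + semidirect_br br (\<triangleright>) g (semidirect_br br (\<triangleright>) h f) +
      semidirect_br br (\<triangleright>) h (semidirect_br br (\<triangleright>) f g) = 0" for f g h
    by (rule semidirect_br_jacobi)
qed (auto simp: scale_right_distrib scale_left_distrib)

text \<open>On diagonal pairs the second component of the bracket is literally the sub-adjacent
  bracket.\<close>

lemma lie_hom_diagonal:
  "lie_hom scale (sub_adjacent br (\<triangleright>)) (pair_scale scale) (semidirect_br br (\<triangleright>)) (\<lambda>x. (x, x))"
  by (simp add: lie_hom_def sub_adjacent_def)

lemma lie_hom_inl:
  "lie_hom scale (sub_adjacent br (\<triangleright>)) (pair_scale scale) (semidirect_br br (\<triangleright>)) (\<lambda>x. (x, 0))"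
  by (simp add: lie_hom_def)

lemma lie_hom_inr:
  "lie_hom scale br (pair_scale scale) (semidirect_br br (\<triangleright>)) (\<lambda>x. (0, x))"
  by (simp add: lie_hom_def)

lemma lie_derivation_tr: "lie_derivation scale br ((\<triangleright>) x)"
  by (simp add: lie_derivation_def tr_add_right tr_scale_right tr_br)

text \<open>On the ideal, (x, 0) acts as D = x \<triangleright> _ and (0, x) as ad x, so the
  polynomial acts as t ad x + D.\<close>

lemma coeff_semidirect_pow:
  "coeff ((poly_br (semidirect_br br (\<triangleright>)) [:(x, 0), (0, x):] ^^ m) [:(0, x):]) n =
   (0, composition_sum scale br (\<lambda>j. ((\<triangleright>) x ^^ j) x) n m (\<lambda>j. ((\<triangleright>) x ^^ j) x))"
proof (induction m arbitrary: n)
  case 0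
  then show ?case
    by (cases n) (simp_all add: composition_sum_def zero_prod_def)
next
  case (Suc m)
  interpret H: lie_algebra "pair_scale scale" "semidirect_br br (\<triangleright>)"
    by (rule lie_algebra_semidirect)
  show ?case
    by (cases n) (simp_all add: H.coeff_poly_br_linear Suc
        derivation_composition_sum_self[OF lie_derivation_tr])
qed

end

section \<open>The p-map of the sub-adjacent Lie algebra\<close>

context trivially_restricted_post_lie_algebra
begin

sublocale H: lie_algebra_char_p "pair_scale scale" "semidirect_br br (\<triangleright>)" p
  using lie_algebra_semidirect char_p p_pos
  by (simp add: lie_algebra_char_p_def lie_algebra_char_p_axioms_def)

sublocale G: lie_algebra_char_p scale br p
  by unfold_locales (rule char_p p_pos)+

abbreviation subadj (infixr \<open>\<star>\<close> 70) where "x \<star> y \<equiv> sub_adjacent br (\<triangleright>) x y"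
abbreviation pmap' where "pmap' \<equiv> post_lie_pmap scale br p pmap (\<triangleright>)"
abbreviation S2 where "S2 \<equiv> jacobson_sum (pair_scale scale) (semidirect_br br (\<triangleright>)) p"

text \<open>The coefficient of t^(i - 1) is the sum over compositions of p into i entries, and
  Jacobson's factor 1/i is the one in \<open>post_lie_pmap\<close>.\<close>

lemma post_lie_pmap_altdef: "S2 (0, x) (x, 0) = (0, pmap' x - pmap x)"
proof -
  have "jacobson_s (pair_scale scale) (semidirect_br br (\<triangleright>)) p i (0, x) (x, 0) =
      (0, scale (1 / of_nat i) (\<Sum>ls\<in>compositions p i.
        scale (composition_coeff p ls) (nested_br br (map (tr_power (\<triangleright>) x) ls))))" if "i \<in> {1..p-1}" for i
    using that p_pos G.composition_sum_altdef[of "p - 1" "\<lambda>j. ((\<triangleright>) x ^^ j) x" "i - 1"]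
    by (simp add: jacobson_s_def coeff_semidirect_pow inverse_eq_divide tr_power_def[abs_def])
  then show ?thesis
    by (simp add: jacobson_sum_def post_lie_pmap_def) (simp add: prod_eq_iff fst_sum snd_sum)
qed

lemma post_lie_pmap_scale: "pmap' (scale c x) = scale (c ^ p) (pmap' x)"
proof -
  have "S2 (0, scale c x) (scale c x, 0) = pair_scale scale (c ^ p) (S2 (0, x) (x, 0))"
    using H.jacobson_sum_scale[of c "(0, x)" "(x, 0)"] by simp
  then show ?thesis
    by (simp add: post_lie_pmap_altdef pmap_scale scale_right_diff_distrib)
qed

text \<open>In h, (0, x) + (0, y) + (x, 0) + (y, 0) is grouped by the summands of h and into the
  diagonal elements (x, x) and (y, y). The second components of the interchange law give the
  claim.\<close>

lemma post_lie_pmap_add: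
  "pmap' (x + y) = pmap' x + pmap' y + jacobson_sum scale (sub_adjacent br (\<triangleright>)) p x y"
proof -
  have diag: "S2 (x, x) (y, y) = (let s = jacobson_sum scale (sub_adjacent br (\<triangleright>)) p x y in (s, s))"
    using lie_hom_jacobson_sum[OF lie_algebra_sub_adjacent H.lie_algebra_axioms lie_hom_diagonal]
    by (simp add: Let_def)
  have inl: "S2 (x, 0) (y, 0) = (jacobson_sum scale (sub_adjacent br (\<triangleright>)) p x y, 0)"
    using lie_hom_jacobson_sum[OF lie_algebra_sub_adjacent H.lie_algebra_axioms lie_hom_inl] by simp
  have inr: "S2 (0, x) (0, y) = (0, jacobson_sum scale br p x y)"
    using lie_hom_jacobson_sum[OF lie_algebra_axioms H.lie_algebra_axioms lie_hom_inr] by simp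
  have "pmap (x + y) = pmap x + pmap y + jacobson_sum scale br p x y"
    by (simp add: pmap_add jacobson_sum_def)
  then show ?thesis
    using H.jacobson_sum_interchange[of "(0, x)" "(0, y)" "(x, 0)" "(y, 0)"]
    by (simp add: diag inl inr post_lie_pmap_altdef Let_def algebra_simps)
qed

text \<open>Jacobson's formula in h for (0, x) + (x, 0) = (x, x), applied to (y, y) and read in the
  second component.\<close>

lemma post_lie_pmap_ad: "pmap' x \<star> y = ((\<star>) x ^^ p) y"
proof -
  let ?b = "semidirect_br br (\<triangleright>)"
  have diag: "(?b (x, x) ^^ p) (y, y) = (((\<star>) x ^^ p) y, ((\<star>) x ^^ p) y)"
    using lie_hom_ad_pow[OF lie_hom_diagonal, where z = x and m = p and v = y] by simp
  have inl: "snd ((?b (x, 0) ^^ m) (y, y)) = ((\<triangleright>) x ^^ m) y" for m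
    by (induction m) (simp_all add: semidirect_br_def split_beta)
  have inr: "(?b (0, x) ^^ m) (0, w) = (0, (br x ^^ m) w)" for m w
    by (induction m) simp_all
  obtain m where m: "p = Suc m"
    using p_pos by (cases p) auto
  \<comment> \<open>The first bracket lands in the ideal at [x, y] - y \<triangleright> x; after
    that only ad x acts.\<close>
  have "(?b (0, x) ^^ p) (y, y) = (0, (br x ^^ p) y - (br x ^^ (p - 1)) (y \<triangleright> x))"
    unfolding m funpow_Suc_right using ad_pow_add[of m x "br x y - y \<triangleright> x" "y \<triangleright> x"]
    by (simp add: inr algebra_simps)
  \<comment> \<open>Both terms become expressions in \<open>pmap x\<close>, which later cancel those
    from the correction \<open>pmap' x - pmap x\<close>.\<close>
  then have inr_pow: "snd ((?b (0, x) ^^ p) (y, y)) = br (pmap x) y - y \<triangleright> pmap x"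
    by (simp add: ad_pmap tr_pmap)
  have "snd (?b (0, pmap' x - pmap x) (y, y)) =
      ((\<star>) x ^^ p) y - snd ((?b (0, x) ^^ p) (y, y)) - ((\<triangleright>) x ^^ p) y"
    using H.ad_jacobson_sum[of "(0, x)" "(x, 0)" "(y, y)"]
    by (simp add: post_lie_pmap_altdef diag flip: inl)
  then have "((\<star>) x ^^ p) y = br (pmap' x) y - y \<triangleright> pmap' x + ((\<triangleright>) x ^^ p) y"
    unfolding inr_pow by (simp add: br_diff_left tr_diff_right algebra_simps)
  \<comment> \<open>The p-fold action of x is that of \<open>pmap' x\<close>, the term still missing
    from the sub-adjacent bracket.\<close>
  then show ?thesis
    by (simp add: sub_adjacent_def post_lie_pmap_tr)
qed

end

theorem proposition3p1p2:
  fixes scale :: "'k::field \<Rightarrow> 'g::ab_group_add \<Rightarrow> 'g"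
    and br tr :: "'g \<Rightarrow> 'g \<Rightarrow> 'g"
    and p :: nat
    and pmap :: "'g \<Rightarrow> 'g"
  assumes "CHAR('k) = p" and "p > 0"
    and "trivially_restricted_post_lie_algebra scale br p pmap tr"
  shows "restricted_lie_algebra scale (sub_adjacent br tr) p (post_lie_pmap scale br p pmap tr)
    \<and> restricted_representation scale (sub_adjacent br tr) p (post_lie_pmap scale br p pmap tr)
        scale (\<lambda>x y. tr x y)"
proof -
  interpret trivially_restricted_post_lie_algebra scale br p pmap tr
    by fact
  have restricted: "restricted_lie_algebra scale (sub_adjacent br tr) p (post_lie_pmap scale br p pmap tr)"
    using lie_algebra_sub_adjacent assms(1,2) post_lie_pmap_scale post_lie_pmap_add post_lie_pmap_ad
    by (simp add: restricted_lie_algebra_def restricted_lie_algebra_axioms_def jacobson_sum_def)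
  moreover have "restricted_representation scale (sub_adjacent br tr) p
      (post_lie_pmap scale br p pmap tr) scale (\<lambda>x y. tr x y)"
    using restricted vector_space_axioms
    by (simp add: restricted_representation_def restricted_representation_axioms_def
        Vector_Spaces.linear_iff tr_add_left tr_add_right tr_scale_left tr_scale_right sub_adjacent_tr
        post_lie_pmap_tr fun_eq_iff)
  ultimately show ?thesis
    by (rule conjI)
qed

end
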